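(* Let $a,b,d\ge 1$ be integers with $\gcd(a,b)=1$, let $\rho=dab(a+b)$, and let $t$ be an integer with $\gcd(t,d)=1$ and $t>B^{\pm}:=dab$. For every $\mathbf v\in\widehat{\mathcal O}_t^{\pm}$, the element $\widehat\varphi_{\pm}(\mathbf v)\in\mathcal O_{t+\rho}^{\pm}$ is reducible in $\mathcal O_{t+\rho}^{\pm}$ if and only if $\mathbf v$ is reducible in $\mathcal O_t^{\pm}$. In particular, $$\widehat\varphi_{\pm}\big(\mathcal H(\mathcal O_t^{\pm})\big)=\mathcal H(\mathcal O_{t+\rho}^{\pm})\qquad\text{and}\qquad |\mathcal H(\mathcal O_t^{\pm})|=|\mathcal H(\mathcal O_{t+\rho}^{\pm})|.$$
   Context: For an integer $s$, $\mathbb L_s=\{(v_0,v_1,v_2)\in\mathbb Z^3:(s-da)v_0+sv_1+(s+db)v_2=0\}$, $\mathcal O_s^{\pm}=\{\mathbf v\in\mathbb L_s : v_0\ge 0,\ v_2\ge 0\}$, and $\widehat{\mathcal O}_s^{\pm}=\{\mathbf v\in\mathcal O_s^{\pm}: v_0\le b\}\cup\{\mathbf v\in\mathcal O_s^{\pm}: v_2\le a\}$. An element of $\mathcal O_s^{\pm}$ is reducible if it is a sum of two nonzero elements of $\mathcal O_s^{\pm}$; the Hilbert basis $\mathcal H(\mathcal O_s^{\pm})$ is the (finite) set of minimal generators of the additive monoid $\mathcal O_s^{\pm}$, i.e. its nonzero non-reducible elements. With $\ell(\mathbf v)=v_0+v_1+v_2$ and standard basis vectors $\mathbf e_0,\mathbf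 e_1,\mathbf e_2$ (indexed by coordinates $0,1,2$), the map $\widehat\varphi_{\pm}:\widehat{\mathcal O}_t^{\pm}\to\widehat{\mathcal O}_{t+\rho}^{\pm}$ is given by $\widehat\varphi_{\pm}(\mathbf v)=\mathbf v+a(a+b)\ell(\mathbf v)(\mathbf e_1-\mathbf e_2)$ if $v_0\le b$, and $\widehat\varphi_{\pm}(\mathbf v)=\mathbf v+b(a+b)\ell(\mathbf v)(\mathbf e_0-\mathbf e_1)$ if $v_2\le a$ (a well-defined map for $t>B^{\pm}$; the two formulas agree when both conditions hold). *)

theory Defs
  imports "HOL-Analysis.Cartesian_Space"
begin

text \<open>
  Vectors in \<open>\<int>\<^sup>3\<close> have type \<open>int ^ 3\<close>. The index type \<open>3\<close> consists of the elements
  \<open>0, 1, 2\<close> (its numeral \<open>3\<close> equals \<open>0\<close>), so \<open>v $ 0\<close>, \<open>v $ 1\<close>, \<open>v $ 2\<close> are the three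
  coordinates, and \<open>axis i 1\<close> is the standard basis vector \<open>e\<^sub>i\<close>.
\<close>

definition lat :: "int \<Rightarrow> int \<Rightarrow> int \<Rightarrow> int \<Rightarrow> (int ^ 3) set" where
  "lat a b d s = {v. (s - d * a) * v $ 0 + s * v $ 1 + (s + d * b) * v $ 2 = 0}"

definition Opm :: "int \<Rightarrow> int \<Rightarrow> int \<Rightarrow> int \<Rightarrow> (int ^ 3) set" where
  "Opm a b d s = {v \<in> lat a b d s. v $ 0 \<ge> 0 \<and> v $ 2 \<ge> 0}"

definition Opm_hat :: "int \<Rightarrow> int \<Rightarrow> int \<Rightarrow> int \<Rightarrow> (int ^ 3) set" where
  "Opm_hat a b d s = {v \<in> Opm a b d s. v $ 0 \<le> b} \<union> {v \<in> Opm a b d s. v $ 2 \<le> a}"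

definition reducible_in :: "'a::monoid_add set \<Rightarrow> 'a \<Rightarrow> bool" where
  "reducible_in M v \<longleftrightarrow> (\<exists>u\<in>M. \<exists>w\<in>M. u \<noteq> 0 \<and> w \<noteq> 0 \<and> v = u + w)"

definition hilbert_basis :: "'a::monoid_add set \<Rightarrow> 'a set" where
  "hilbert_basis M = {v \<in> M. v \<noteq> 0 \<and> \<not> reducible_in M v}"

definition ell :: "int ^ 3 \<Rightarrow> int" where
  "ell v = v $ 0 + v $ 1 + v $ 2"

text \<open>
  The map is specified by two formulas, one for \<open>v $ 0 \<le> b\<close> and one for \<open>v $ 2 \<le> a\<close>.
  On \<open>Opm_hat a b d t\<close> with \<open>t > d * a * b\<close> they agree where both apply (see \<open>phi_hat_eq2\<close>), so
  testing \<open>v $ 0 \<le> b\<close> first loses nothing. Values outside \<open>Opm_hat\<close> are irrelevant.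
\<close>

definition phi_hat :: "int \<Rightarrow> int \<Rightarrow> int ^ 3 \<Rightarrow> int ^ 3" where
  "phi_hat a b v =
    (if v $ 0 \<le> b then v + (a * (a + b) * ell v) *s (axis 1 1 - axis 2 1)
     else v + (b * (a + b) * ell v) *s (axis 0 1 - axis 1 1))"

lemma Opm_ell:
  assumes "v \<in> Opm a b d t"
  shows "t * ell v = d * a * v $ 0 - d * b * v $ 2"
  using assms by (simp add: Opm_def lat_def ell_def algebra_simps)

lemma ell_nonpos:
  assumes "a \<ge> 1" "b \<ge> 1" "d \<ge> 1" "t > d * a * b" "v \<in> Opm a b d t" "v $ 0 \<le> b"
  shows "ell v \<le> 0"
proof (rule ccontr)
  assume "\<not> ell v \<le> 0"
  moreover have "d * a * b \<ge> 0" using assms by simp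
  ultimately have "t \<le> t * ell v" using assms(4) by simp
  moreover have "d * a * v $ 0 \<le> d * a * b" using assms by simp
  moreover have "d * b * v $ 2 \<ge> 0" using assms by (simp add: Opm_def)
  ultimately show False using Opm_ell[OF assms(5)] assms(4) by linarith
qed

lemma ell_nonneg:
  assumes "a \<ge> 1" "b \<ge> 1" "d \<ge> 1" "t > d * a * b" "v \<in> Opm a b d t" "v $ 2 \<le> a"
  shows "ell v \<ge> 0"
proof (rule ccontr)
  assume "\<not> ell v \<ge> 0"
  moreover have "d * a * b \<ge> 0" using assms by simp
  ultimately have "t * ell v \<le> t * (-1)" using assms(4) by (intro mult_left_mono) auto
  moreover have "d * b * v $ 2 \<le> d * b * a" using assms by simp
  moreover have "d * a * v $ 0 \<ge> 0" using assms by (simp add: Opm_def)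
  ultimately show False using Opm_ell[OF assms(5)] assms(4) by (simp add: mult.assoc mult.commute[of a b])
qed

lemma phi_hat_eq1:
  assumes "v $ 0 \<le> b"
  shows "phi_hat a b v = v + (a * (a + b) * ell v) *s (axis 1 1 - axis 2 1)"
  using assms by (simp add: phi_hat_def)

lemma phi_hat_eq2:
  assumes "a \<ge> 1" "b \<ge> 1" "d \<ge> 1" "t > d * a * b" "v \<in> Opm_hat a b d t" "v $ 2 \<le> a"
  shows "phi_hat a b v = v + (b * (a + b) * ell v) *s (axis 0 1 - axis 1 1)"
proof (cases "v $ 0 \<le> b")
  case True
  have "v \<in> Opm a b d t" using assms(5) by (auto simp: Opm_hat_def)
  with True have "ell v = 0"
    using ell_nonpos[of a b d t v] ell_nonneg[of a b d t v] assms by force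
  then show ?thesis by (simp add: phi_hat_def)
qed (simp add: phi_hat_def)

lemma phi_hat_in:
  assumes "a \<ge> 1" "b \<ge> 1" "d \<ge> 1" "t > d * a * b" "v \<in> Opm_hat a b d t"
  shows "phi_hat a b v \<in> Opm_hat a b d (t + d * a * b * (a + b))"
proof -
  have v: "v \<in> Opm a b d t" using assms(5) by (auto simp: Opm_hat_def)
  show ?thesis
  proof (cases "v $ 0 \<le> b")
    case True
    have "a * (a + b) * ell v \<le> 0"
      using ell_nonpos[OF assms(1-4) v True] assms by (simp add: mult_nonneg_nonpos)
    moreover have "phi_hat a b v \<in> lat a b d (t + d * a * b * (a + b))"
      using v True by (simp add: phi_hat_def Opm_def lat_def axis_def ell_def algebra_simps)
    ultimately show ?thesis using v True
      by (simp add: phi_hat_def Opm_hat_def Opm_def axis_def)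
  next
    case False
    then have v2: "v $ 2 \<le> a" using assms(5) by (auto simp: Opm_hat_def)
    have "b * (a + b) * ell v \<ge> 0"
      using ell_nonneg[OF assms(1-4) v v2] assms by simp
    moreover have "phi_hat a b v \<in> lat a b d (t + d * a * b * (a + b))"
      using v False by (simp add: phi_hat_def Opm_def lat_def axis_def ell_def algebra_simps)
    ultimately show ?thesis using v v2 False
      by (simp add: phi_hat_def Opm_hat_def Opm_def axis_def)
  qed
qed

lemma hilbert_basis_subset_Opm_hat:
  assumes "a \<ge> 1" "b \<ge> 1"
  shows "hilbert_basis (Opm a b d s) \<subseteq> Opm_hat a b d s"
proof
  fix v assume v: "v \<in> hilbert_basis (Opm a b d s)"
  show "v \<in> Opm_hat a b d s"
  proof (rule ccontr)
    assume "v \<notin> Opm_hat a b d s"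
    with v have big: "v $ 0 > b" "v $ 2 > a" and vO: "v \<in> Opm a b d s"
      by (auto simp: Opm_hat_def hilbert_basis_def)
    define w :: "int ^ 3" where "w = b *s axis 0 1 - (a + b) *s axis 1 1 + a *s axis 2 1"
    have w: "w $ 0 = b" "w $ 1 = - a - b" "w $ 2 = a" by (simp_all add: w_def axis_def)
    have "w \<in> lat a b d s"
      unfolding lat_def mem_Collect_eq w by (simp add: algebra_simps)
    then have "w \<in> Opm a b d s" "v - w \<in> Opm a b d s"
      using w big vO assms by (auto simp: Opm_def lat_def right_diff_distrib)
    moreover have "w \<noteq> 0" "v - w \<noteq> 0" using w big assms by auto
    moreover have "v = w + (v - w)" by simp
    ultimately have "reducible_in (Opm a b d s) v" unfolding reducible_in_def by blast
    with v show False by (simp add: hilbert_basis_def)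
  qed
qed

text \<open>Finiteness, so that \<open>card\<close> of a Hilbert basis is its true cardinality.\<close>

lemma finite_hilbert_basis_Opm:
  assumes "a \<ge> 1" "b \<ge> 1"
  shows "finite (hilbert_basis (Opm a b d s))"
proof -
  let ?O = "Opm a b d s" and ?H = "hilbert_basis (Opm a b d s)"
  have anti: "u = v" if "u \<in> ?H" "v \<in> ?H" "u $ 0 \<le> v $ 0" "u $ 2 \<le> v $ 2" for u v
  proof (rule ccontr)
    assume "u \<noteq> v"
    have "v - u \<in> ?O" using that by (auto simp: hilbert_basis_def Opm_def lat_def algebra_simps)
    moreover have "u \<in> ?O" "u \<noteq> 0" using that by (auto simp: hilbert_basis_def)
    moreover have "v - u \<noteq> 0" "v = u + (v - u)" using \<open>u \<noteq> v\<close> by auto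
    ultimately have "reducible_in ?O v" unfolding reducible_in_def by blast
    with that show False by (simp add: hilbert_basis_def)
  qed
  have A: "finite {v \<in> ?H. v $ 0 = c}" for c
  proof (rule finite_subset)
    show "{v \<in> ?H. v $ 0 = c} \<subseteq> {SOME v. v \<in> ?H \<and> v $ 0 = c}"
    proof
      fix v assume v: "v \<in> {v \<in> ?H. v $ 0 = c}"
      let ?w = "SOME v. v \<in> ?H \<and> v $ 0 = c"
      have "?w \<in> ?H \<and> ?w $ 0 = c" by (rule someI[of _ v]) (use v in auto)
      then have "v = ?w" using anti[of v ?w] anti[of ?w v] v by force
      then show "v \<in> {?w}" by simp
    qed
  qed simp
  have B: "finite {v \<in> ?H. v $ 2 = c}" for c
  proof (rule finite_subset)
    show "{v \<in> ?H. v $ 2 = c} \<subseteq> {SOME v. v \<in> ?H \<and> v $ 2 = c}"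
    proof
      fix v assume v: "v \<in> {v \<in> ?H. v $ 2 = c}"
      let ?w = "SOME v. v \<in> ?H \<and> v $ 2 = c"
      have "?w \<in> ?H \<and> ?w $ 2 = c" by (rule someI[of _ v]) (use v in auto)
      then have "v = ?w" using anti[of v ?w] anti[of ?w v] v by force
      then show "v \<in> {?w}" by simp
    qed
  qed simp
  have "?H \<subseteq> (\<Union>c\<in>{0..b}. {v \<in> ?H. v $ 0 = c}) \<union> (\<Union>c\<in>{0..a}. {v \<in> ?H. v $ 2 = c})"
    using hilbert_basis_subset_Opm_hat[OF assms, of d s]
    by (auto simp: Opm_hat_def Opm_def)
  then show ?thesis by (rule finite_subset) (use A B in auto)
qed

end

theory Submission
  imports Defs
begin

text \<open>
  Membership of \<open>v\<close> in the lattice at level \<open>s\<close> says \<open>s * ell v = d * (a * v $ 0 - b * v $ 2)\<close>.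
  Adding \<open>\<rho> * ell v\<close> to both sides shows that raising the level from \<open>t\<close> to \<open>t + \<rho>\<close> can be
  compensated by a shear which keeps \<open>ell\<close> and changes only one of the two sign-constrained
  coordinates: either lower \<open>v $ 2\<close> by \<open>a * (a + b) * ell v\<close>, or raise \<open>v $ 0\<close> by
  \<open>b * (a + b) * ell v\<close>. Both shears are invertible and additive. On the slab \<open>v $ 0 \<le> b\<close> the
  condition \<open>t > d * a * b\<close> forces \<open>ell v \<le> 0\<close>, and then the first shear preserves and reflects
  membership in the monoid; on the slab \<open>v $ 2 \<le> a\<close> it forces \<open>ell v \<ge> 0\<close>, and the second shear
  does so (\<open>shear12_mem_iff\<close>, \<open>shear01_mem_iff\<close>).

  Each slab bounds a coordinate which is nonnegative on the monoid, so it contains both summands of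
  any decomposition of its elements. A decomposition therefore never mixes the two formulas for
  \<open>phi_hat\<close>: it is carried over, in both directions, by a single additive bijection
  (\<open>reducible_in_transfer\<close>). The sign of \<open>ell\<close>, which both shears preserve, tells the two formulas
  apart, so \<open>phi_hat\<close> is a bijection between the unions of the slabs; since these contain the
  Hilbert bases, the statements on Hilbert bases follow.
\<close>

section \<open>Transfer of reducibility along additive bijections\<close>

text \<open>
  \<open>f\<close> need match \<open>M\<close> with \<open>N\<close> only on a region \<open>P\<close>, provided that \<open>P\<close> inherits to
  summands: all decompositions of an element of \<open>P\<close> then stay where \<open>f\<close> is known.
\<close>

lemma reducible_in_transfer:
  fixes f :: "'a::monoid_add \<Rightarrow> 'b::monoid_add"
  assumes add: "\<And>u w. f (u + w) = f u + f w" and zero: "f 0 = 0" and "bij f"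
    and mem: "\<And>u. P u \<Longrightarrow> f u \<in> N \<longleftrightarrow> u \<in> M"
    and down_M: "\<And>u w. u \<in> M \<Longrightarrow> w \<in> M \<Longrightarrow> P (u + w) \<Longrightarrow> P u \<and> P w"
    and down_N: "\<And>u w. f u \<in> N \<Longrightarrow> f w \<in> N \<Longrightarrow> P (u + w) \<Longrightarrow> P u \<and> P w"
    and "P v"
  shows "reducible_in N (f v) \<longleftrightarrow> reducible_in M v"
proof
  have inj: "f u = f w \<longleftrightarrow> u = w" for u w
    using \<open>bij f\<close> by (simp add: bij_def inj_eq)
  have nonzero: "f u \<noteq> 0 \<longleftrightarrow> u \<noteq> 0" for u
    using inj[of u 0] zero by simp
  show "reducible_in M v" if red: "reducible_in N (f v)"
  proof -
    obtain u w where uw: "f u \<in> N" "f w \<in> N" "f u \<noteq> 0" "f w \<noteq> 0" "f v = f u + f w"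
      using red \<open>bij f\<close> unfolding reducible_in_def by (metis bij_pointE)
    then have "v = u + w" using inj add by metis
    moreover from this have "P u" "P w" using down_N uw \<open>P v\<close> by auto
    ultimately show ?thesis using uw mem nonzero unfolding reducible_in_def by blast
  qed
  show "reducible_in N (f v)" if red: "reducible_in M v"
  proof -
    obtain u w where uw: "u \<in> M" "w \<in> M" "u \<noteq> 0" "w \<noteq> 0" "v = u + w"
      using red unfolding reducible_in_def by blast
    then have "P u" "P w" using down_M \<open>P v\<close> by auto
    then show ?thesis using uw mem nonzero add unfolding reducible_in_def by metis
  qed
qed

section \<open>Shears along coordinate differences\<close>

definition shear :: "int \<Rightarrow> 3 \<Rightarrow> 3 \<Rightarrow> int ^ 3 \<Rightarrow> int ^ 3" where
  "shear k p q v = v + (k * ell v) *s (axis p 1 - axis q 1)"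

lemma shear_nth:
  "shear k p q v $ i = v $ i + k * ell v * ((if i = p then 1 else 0) - (if i = q then 1 else 0))"
  by (simp add: shear_def axis_def)

lemma ell_shear [simp]: "ell (shear k p q v) = ell v"
proof -
  have "(p = 0 \<or> p = 1 \<or> p = 2) \<and> (q = 0 \<or> q = 1 \<or> q = 2)"
    using exhaust_3[of p] exhaust_3[of q] by auto
  then show ?thesis
    unfolding ell_def shear_nth by (auto simp: algebra_simps)
qed

lemma ell_add: "ell (u + w) = ell u + ell w"
  by (simp add: ell_def)

lemma shear_add: "shear k p q (u + w) = shear k p q u + shear k p q w"
  by (simp add: vec_eq_iff shear_nth ell_add algebra_simps)

lemma shear_zero [simp]: "shear k p q 0 = 0"
  by (simp add: vec_eq_iff shear_nth ell_def)

lemma shear_neg_shear [simp]: "shear (- k) p q (shear k p q v) = v"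
  by (simp add: vec_eq_iff shear_nth[of "- k"]) (simp add: shear_nth algebra_simps)

lemma bij_shear: "bij (shear k p q)"
  by (rule o_bij[of "shear (- k) p q"])
    (use shear_neg_shear[of "- k" p q] in \<open>auto simp: fun_eq_iff\<close>)

section \<open>The two branches of the map\<close>

lemma Opm_iff:
  "v \<in> Opm a b d s \<longleftrightarrow> s * ell v = d * a * v $ 0 - d * b * v $ 2 \<and> v $ 0 \<ge> 0 \<and> v $ 2 \<ge> 0"
  by (auto simp: Opm_def lat_def ell_def algebra_simps)

locale level_shift =
  fixes a b d t :: int
  assumes a: "a \<ge> 1" and b: "b \<ge> 1" and d: "d \<ge> 1" and t: "t > d * a * b"
begin

abbreviation "t' \<equiv> t + d * a * b * (a + b)"

lemma t_pos: "t > 0" and t'_gt: "t' > d * a * b"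
proof -
  have "d * a * b \<ge> 0" "d * a * b * (a + b) \<ge> 0" using a b d by simp_all
  with t show "t > 0" "t' > d * a * b" by linarith+
qed

text \<open>
  Here \<open>ell v \<le> 0\<close>, so the shear does not decrease \<open>v $ 2\<close>. In the other direction the lattice equation
  at level \<open>t\<close> makes \<open>d * b * v $ 2\<close> equal to \<open>d * a * v $ 0 - t * ell v\<close>, a sum of two nonnegative
  terms.
\<close>

lemma shear12_mem_iff:
  assumes "v $ 0 \<le> b"
  shows "shear (a * (a + b)) 1 2 v \<in> Opm a b d t' \<longleftrightarrow> v \<in> Opm a b d t"
proof
  let ?w = "shear (a * (a + b)) 1 2 v"
  have w: "?w $ 0 = v $ 0" "?w $ 2 = v $ 2 - a * (a + b) * ell v"
    by (simp_all add: shear_nth)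
  show "?w \<in> Opm a b d t'" if v: "v \<in> Opm a b d t"
  proof -
    have "a * (a + b) * ell v \<le> 0"
      using ell_nonpos[OF a b d t v assms] a b by (simp add: mult_nonneg_nonpos)
    then show ?thesis using v unfolding Opm_iff ell_shear w by (simp add: algebra_simps)
  qed
  show "v \<in> Opm a b d t" if m: "?w \<in> Opm a b d t'"
  proof -
    have "ell v \<le> 0" using ell_nonpos[OF a b d t'_gt m] assms w by simp
    moreover have eq: "t * ell v = d * a * v $ 0 - d * b * v $ 2" and "v $ 0 \<ge> 0"
      using m unfolding Opm_iff ell_shear w by (simp_all add: algebra_simps)
    moreover have "d * a * v $ 0 \<ge> 0" using \<open>v $ 0 \<ge> 0\<close> a d by simp
    moreover have "t * ell v \<le> 0" using \<open>ell v \<le> 0\<close> t_pos by (simp add: mult_nonneg_nonpos)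
    ultimately have "d * b * v $ 2 \<ge> 0" by linarith
    moreover have "d * b > 0" using b d by simp
    ultimately have "v $ 2 \<ge> 0" by (simp add: zero_le_mult_iff)
    then show ?thesis using eq \<open>v $ 0 \<ge> 0\<close> by (simp add: Opm_iff)
  qed
qed

lemma shear01_mem_iff:
  assumes "v $ 2 \<le> a"
  shows "shear (b * (a + b)) 0 1 v \<in> Opm a b d t' \<longleftrightarrow> v \<in> Opm a b d t"
proof
  let ?w = "shear (b * (a + b)) 0 1 v"
  have w: "?w $ 0 = v $ 0 + b * (a + b) * ell v" "?w $ 2 = v $ 2"
    by (simp_all add: shear_nth)
  show "?w \<in> Opm a b d t'" if v: "v \<in> Opm a b d t"
  proof -
    have "b * (a + b) * ell v \<ge> 0"
      using ell_nonneg[OF a b d t v assms] a b by simp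
    then show ?thesis using v unfolding Opm_iff ell_shear w by (simp add: algebra_simps)
  qed
  show "v \<in> Opm a b d t" if m: "?w \<in> Opm a b d t'"
  proof -
    have "ell v \<ge> 0" using ell_nonneg[OF a b d t'_gt m] assms w by simp
    moreover have eq: "t * ell v = d * a * v $ 0 - d * b * v $ 2" and "v $ 2 \<ge> 0"
      using m unfolding Opm_iff ell_shear w by (simp_all add: algebra_simps)
    moreover have "d * b * v $ 2 \<ge> 0" using \<open>v $ 2 \<ge> 0\<close> b d by simp
    moreover have "t * ell v \<ge> 0" using \<open>ell v \<ge> 0\<close> t_pos by simp
    ultimately have "d * a * v $ 0 \<ge> 0" by linarith
    moreover have "d * a > 0" using a d by simp
    ultimately have "v $ 0 \<ge> 0" by (simp add: zero_le_mult_iff)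
    then show ?thesis using eq \<open>v $ 2 \<ge> 0\<close> by (simp add: Opm_iff)
  qed
qed

lemma phi_hat_low0: "v $ 0 \<le> b \<Longrightarrow> phi_hat a b v = shear (a * (a + b)) 1 2 v"
  by (simp add: phi_hat_eq1 shear_def)

lemma phi_hat_low2:
  "v \<in> Opm_hat a b d t \<Longrightarrow> v $ 2 \<le> a \<Longrightarrow> phi_hat a b v = shear (b * (a + b)) 0 1 v"
  by (simp add: phi_hat_eq2[OF a b d t] shear_def)

theorem reducible_phi_hat_iff:
  assumes v: "v \<in> Opm_hat a b d t"
  shows "reducible_in (Opm a b d t') (phi_hat a b v) \<longleftrightarrow> reducible_in (Opm a b d t) v"
proof (cases "v $ 0 \<le> b")
  case True
  show ?thesis
    unfolding phi_hat_low0[OF True]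
  proof (rule reducible_in_transfer[where P = "\<lambda>u. u $ 0 \<le> b"])
    fix u :: "int ^ 3" assume "u $ 0 \<le> b"
    then show "shear (a * (a + b)) 1 2 u \<in> Opm a b d t' \<longleftrightarrow> u \<in> Opm a b d t"
      by (rule shear12_mem_iff)
  qed (use True in \<open>auto simp: shear_add bij_shear Opm_def shear_nth\<close>)
next
  case False
  then have low: "v $ 2 \<le> a" using v by (auto simp: Opm_hat_def)
  show ?thesis
    unfolding phi_hat_low2[OF v low]
  proof (rule reducible_in_transfer[where P = "\<lambda>u. u $ 2 \<le> a"])
    fix u :: "int ^ 3" assume "u $ 2 \<le> a"
    then show "shear (b * (a + b)) 0 1 u \<in> Opm a b d t' \<longleftrightarrow> u \<in> Opm a b d t"
      by (rule shear01_mem_iff)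
  qed (use low in \<open>auto simp: shear_add bij_shear Opm_def shear_nth\<close>)
qed

section \<open>Bijectivity and Hilbert bases\<close>

text \<open>
  Both shears preserve \<open>ell\<close>, so two vectors with the same image fall into the same branch of this
  case distinction, and injectivity reduces to that of a single shear.
\<close>

lemma phi_hat_by_sign:
  assumes v: "v \<in> Opm_hat a b d t"
  shows "phi_hat a b v =
    (if ell v \<le> 0 then shear (a * (a + b)) 1 2 v else shear (b * (a + b)) 0 1 v)"
proof (cases "v $ 0 \<le> b")
  case True
  have "v \<in> Opm a b d t" using v by (auto simp: Opm_hat_def)
  then have "ell v \<le> 0" using ell_nonpos[OF a b d t] True by blast
  then show ?thesis by (simp add: phi_hat_low0[OF True])
next
  case False
  then have low: "v $ 2 \<le> a" and "v \<in> Opm a b d t" using v by (auto simp: Opm_hat_def)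
  then have "ell v \<ge> 0" using ell_nonneg[OF a b d t] by blast
  then show ?thesis
    \<comment> \<open>where \<open>ell v = 0\<close>, both shears fix \<open>v\<close>\<close>
    by (cases "ell v = 0") (simp_all add: phi_hat_low2[OF v low] shear_def)
qed

lemma bij_betw_phi_hat: "bij_betw (phi_hat a b) (Opm_hat a b d t) (Opm_hat a b d t')"
  unfolding bij_betw_def
proof
  show "inj_on (phi_hat a b) (Opm_hat a b d t)"
  proof (rule inj_onI)
    fix u v assume uv: "u \<in> Opm_hat a b d t" "v \<in> Opm_hat a b d t" "phi_hat a b u = phi_hat a b v"
    then have "ell u = ell v" by (metis phi_hat_by_sign ell_shear)
    with uv show "u = v" by (metis phi_hat_by_sign shear_neg_shear)
  qed
  show "phi_hat a b ` Opm_hat a b d t = Opm_hat a b d t'"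
  proof
    show "phi_hat a b ` Opm_hat a b d t \<subseteq> Opm_hat a b d t'"
      using phi_hat_in[OF a b d t] by blast
    show "Opm_hat a b d t' \<subseteq> phi_hat a b ` Opm_hat a b d t"
    proof
      fix w assume "w \<in> Opm_hat a b d t'"
      then consider "w \<in> Opm a b d t'" "w $ 0 \<le> b" | "w \<in> Opm a b d t'" "w $ 2 \<le> a"
        by (auto simp: Opm_hat_def)
      then show "w \<in> phi_hat a b ` Opm_hat a b d t"
      proof cases
        case 1
        obtain v where w: "w = shear (a * (a + b)) 1 2 v"
          using bij_shear by (metis bij_pointE)
        with 1 have low: "v $ 0 \<le> b" by (simp add: shear_nth)
        with 1 w have "v \<in> Opm_hat a b d t" by (simp add: Opm_hat_def shear12_mem_iff)
        then show ?thesis using phi_hat_low0[OF low] w by (metis imageI)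
      next
        case 2
        obtain v where w: "w = shear (b * (a + b)) 0 1 v"
          using bij_shear by (metis bij_pointE)
        with 2 have low: "v $ 2 \<le> a" by (simp add: shear_nth)
        with 2 w have v: "v \<in> Opm_hat a b d t" by (simp add: Opm_hat_def shear01_mem_iff)
        then show ?thesis using phi_hat_low2[OF v low] w by (metis imageI)
      qed
    qed
  qed
qed

lemma hilbert_basis_eq_Opm_hat:
  "hilbert_basis (Opm a b d s) =
    {v \<in> Opm_hat a b d s. v \<noteq> 0 \<and> \<not> reducible_in (Opm a b d s) v}"
proof -
  have "Opm_hat a b d s \<subseteq> Opm a b d s" by (auto simp: Opm_hat_def)
  then show ?thesis
    using hilbert_basis_subset_Opm_hat[OF a b, of d s] by (auto simp: hilbert_basis_def)
qed

theorem bij_betw_hilbert_basis: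
  "bij_betw (phi_hat a b) (hilbert_basis (Opm a b d t)) (hilbert_basis (Opm a b d t'))"
proof -
  have nonzero: "phi_hat a b v \<noteq> 0 \<longleftrightarrow> v \<noteq> 0" if "v \<in> Opm_hat a b d t" for v
    using phi_hat_by_sign[OF that] by (metis shear_neg_shear shear_zero)
  have inj: "inj_on (phi_hat a b) (Opm_hat a b d t)"
    and img: "Opm_hat a b d t' = phi_hat a b ` Opm_hat a b d t"
    using bij_betw_phi_hat by (auto simp: bij_betw_def)
  have "phi_hat a b ` hilbert_basis (Opm a b d t) = hilbert_basis (Opm a b d t')"
    unfolding hilbert_basis_eq_Opm_hat img using nonzero reducible_phi_hat_iff by auto
  moreover have "inj_on (phi_hat a b) (hilbert_basis (Opm a b d t))"
    by (rule inj_on_subset[OF inj hilbert_basis_subset_Opm_hat[OF a b]])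
  ultimately show ?thesis by (simp add: bij_betw_def)
qed

end

theorem theorem3p5:
  fixes a b d t \<rho> :: int
  assumes "a \<ge> 1" and "b \<ge> 1" and "d \<ge> 1"
    and "coprime a b"
    and "\<rho> = d * a * b * (a + b)"
    and "coprime t d"
    and "t > d * a * b"
  shows "(\<forall>v \<in> Opm_hat a b d t.
            reducible_in (Opm a b d (t + \<rho>)) (phi_hat a b v) \<longleftrightarrow> reducible_in (Opm a b d t) v)
       \<and> phi_hat a b ` hilbert_basis (Opm a b d t) = hilbert_basis (Opm a b d (t + \<rho>))
       \<and> card (hilbert_basis (Opm a b d t)) = card (hilbert_basis (Opm a b d (t + \<rho>)))"
proof -
  interpret level_shift a b d t
    using assms by unfold_locales
  show ?thesis
    unfolding \<open>\<rho> = d * a * b * (a + b)\<close>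
    using reducible_phi_hat_iff bij_betw_hilbert_basis bij_betw_same_card
    by (auto simp: bij_betw_def)
qed

end
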